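(* (Corrected boundary condition.) Consider the UGKS with the left boundary value and left macroscopic boundary flux $$\rho^n_{1/2}=2\langle Wf_L\mathbf 1_{v>0}\rangle,$$ $$\Phi_{1/2}=-\frac{2\langle v\mathbf 1_{v<0}\rangle}{\varepsilon}\langle Wf_L\mathbf 1_{v>0}\rangle+A_{1/2}\langle vf_1^n\mathbf 1_{v<0}\rangle+\langle v\mathbf 1_{v<0}\rangle C_{1/2}\rho^n_{1/2}+\langle v^2\mathbf 1_{v<0}\rangle D_{1/2}\,\delta_x\rho^{nR}_{1/2}+\langle v\mathbf 1_{v<0}\rangle E_{1/2}G,$$ the same $\rho^n_{1/2}$ being used in the left microscopic boundary flux $\phi_{1/2}$. These definitions ensure that $\Phi_{1/2}$ is uniformly bounded with respect to $\varepsilon$, and moreover that, as $\varepsilon\to0$, the discrete conservation law in the first cell $i=1$ tends to $$\frac{\rho_1^{n+1}-\rho_1^n}{\Delta t}-\frac1{\Delta x}\biggl(\frac{1}{3\sigma_{3/2}}\frac{\rho_2^n-\rho_1^n}{\Delta x}-\frac{1}{3\sigma_{1/2}}\frac{\rho_1^n-\rho^n_{1/2}}{\Delta x}\biggr)=-\alpha_1\rho_1^{n+1}+G$$ with the correct Dirichlet boundary data $\rho^n_{1/2}=2\langle Wf_L\mathbf 1_{v>0}\rangle$.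
   Context: The average of a function $\phi$ of $v\in[-1,1]$ is $\langle\phi\rangle=\frac12\int_{-1}^1\phi(v)\,dv$; $\mathbf 1_{v>0},\mathbf 1_{v<0}$ are indicator functions. The unified gas kinetic scheme (UGKS) approximates the linear kinetic equation $\varepsilon\partial_tf+v\partial_xf=\frac{\sigma}{\varepsilon}(\langle f\rangle-f)-\varepsilon\alpha f+\varepsilon G$ for $x\in[0,1]$, with boundary data $f(t,0,v)=f_L(v)$ for $v>0$, where $f_L$ may depend on $v$ (non isotropic data); $\sigma,\alpha,G$ may depend on $x$ but not on $v$. The diffusion limit as $\varepsilon\to0$ is $\partial_t\rho-\partial_x(\frac{1}{3\sigma}\partial_x\rho)=-\alpha\rho+G$. For non isotropic data, $f$ is well approximated by the solution $\rho$ of the diffusion equation outside the boundary layer only if this equation is supplemented by the boundary condition $\rho(t,0)=\int_0^1W(v)f_L(v)\,dv=2\langle Wf_L\mathbf 1_{v>0}\rangle$, where $W$ is the special function of boundary layer theory that is well approximated by $0.956v+1.565v^2\approx\frac32v^2+v$; this is the "correct" Dirichlet value. The grid has space step $\Delta x$ and time step $\Delta t$, with first cell $[x_{1/2},x_{3/2}]$, $x_{1/2}=0$; $f_i^n(v)$ is the approximation of the average of $f(t_n,\cdot,v)$ over cell $i$, $\rho_i^n=\langle f_i^n\rangle$, $\alpha_1$ is the value of $\alpha$ in the first cell, and subscripts $1/2$, $3/2$ denote interface values. The discrete conservation law in the first cell is $$\frac{\rho_1^{n+1}-\rho_1^n}{\Delta t}+\frac1{\Delta x}(\Phi_{3/2}-\Phi_{1/2})=-\alpha_1\rho_1^{n+1}+G,$$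 with interior flux $$\Phi_{3/2}=A_{3/2}\langle vf_1^n\mathbf 1_{v>0}+vf_2^n\mathbf 1_{v<0}\rangle+D_{3/2}\frac13\frac{\rho_2^n-\rho_1^n}{\Delta x}.$$ The right slope at the left boundary is $\delta_x\rho^{nR}_{1/2}=\frac{\rho_1^n-\rho^n_{1/2}}{\Delta x/2}$ and the left microscopic boundary flux is $$\phi_{1/2}=\frac v\varepsilon f_L\mathbf 1_{v>0}+A_{1/2}vf_1^n\mathbf 1_{v<0}+C_{1/2}v\rho^n_{1/2}\mathbf 1_{v<0}+D_{1/2}v^2\delta_x\rho^{nR}_{1/2}\mathbf 1_{v<0}+E_{1/2}vG\mathbf 1_{v<0}.$$ With $\nu=\frac{\sigma}{\varepsilon^2}+\alpha$, $A=\frac{1}{\Delta t\varepsilon\nu}(1-e^{-\nu\Delta t})$, $C=\frac{\sigma}{\Delta t\varepsilon^3\nu}\bigl(\Delta t-\frac1\nu(1-e^{-\nu\Delta t})\bigr)$, $D=-\frac{\sigma}{\Delta t\varepsilon^4\nu^2}\bigl(\Delta t(1+e^{-\nu\Delta t})-\frac2\nu(1-e^{-\nu\Delta t})\bigr)$, $E=\frac{1}{\Delta t\varepsilon\nu}\bigl(\Delta t-\frac1\nu(1-e^{-\nu\Delta t})\bigr)$; a subscript $1/2$ or $3/2$ means evaluation at $(\sigma,\alpha)=(\sigma_{1/2},\alpha_{1/2})$ or $(\sigma_{3/2},\alpha_{3/2})$. *)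

theory Defs
  imports "HOL-Analysis.Analysis"
begin

definition avg :: "(real \<Rightarrow> real) \<Rightarrow> real" where
  "avg \<phi> = 1 / 2 * (LBINT v:{-1..1}. \<phi> v)"

abbreviation vpos :: "real \<Rightarrow> real" where
  "vpos \<equiv> indicator {0<..}"

abbreviation vneg :: "real \<Rightarrow> real" where
  "vneg \<equiv> indicator {..<0}"

(* Half-space (Milne) problem of boundary layer theory with incoming data g,
   in the stretched variable y = sigma x / epsilon:
   v d_y h = <h> - h for y > 0, h(0,v) = g(v) for v > 0, h bounded.
   The velocity v = 0, a null set, is left out. *)
definition milne_solution :: "(real \<Rightarrow> real) \<Rightarrow> (real \<Rightarrow> real \<Rightarrow> real) \<Rightarrow> bool" where
  "milne_solution g h \<longleftrightarrow>
     (\<exists>B. \<forall>y>0. \<forall>v\<in>{-1..1}. \<bar>h y v\<bar> \<le> B) \<and>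
     (\<forall>y>0. set_borel_measurable lborel {-1..1} (h y)) \<and>
     (\<forall>y>0. \<forall>v\<in>{-1..1} - {0}.
        ((\<lambda>z. h z v) has_real_derivative (avg (h y) - h y v) / v) (at y)) \<and>
     (\<forall>v\<in>{0<..1}. ((\<lambda>y. h y v) \<longlongrightarrow> g v) (at_right 0))"

(* The special function W: the bounded Milne solution with incoming data g tends, at the
   outer edge of the layer, to the constant int_0^1 W g.  This determines W almost everywhere
   on [0,1]; explicitly W(v) = sqrt 3 / 2 * v * H(v), with H Chandrasekhar's function for
   conservative isotropic scattering, and 0.956 v + 1.565 v^2 is a numerical fit of it. *)
definition boundary_layer_weight :: "(real \<Rightarrow> real) \<Rightarrow> bool" where
  "boundary_layer_weight W \<longleftrightarrow>
     set_integrable lborel {0..1} W \<and>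
     (\<forall>g h. continuous_on {0..1} g \<longrightarrow> milne_solution g h \<longrightarrow>
        (\<forall>v\<in>{-1..1} - {0}. ((\<lambda>y. h y v) \<longlongrightarrow> (LBINT u:{0..1}. W u * g u)) at_top))"

definition nu :: "real \<Rightarrow> real \<Rightarrow> real \<Rightarrow> real" where
  "nu \<epsilon> \<sigma> \<alpha> = \<sigma> / \<epsilon>\<^sup>2 + \<alpha>"

definition coefA :: "real \<Rightarrow> real \<Rightarrow> real \<Rightarrow> real \<Rightarrow> real" where
  "coefA \<Delta>t \<epsilon> \<sigma> \<alpha> = (let \<nu> = nu \<epsilon> \<sigma> \<alpha> in
     1 / (\<Delta>t * \<epsilon> * \<nu>) * (1 - exp (- \<nu> * \<Delta>t)))"

definition coefC :: "real \<Rightarrow> real \<Rightarrow> real \<Rightarrow> real \<Rightarrow> real" where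
  "coefC \<Delta>t \<epsilon> \<sigma> \<alpha> = (let \<nu> = nu \<epsilon> \<sigma> \<alpha> in
     \<sigma> / (\<Delta>t * \<epsilon> ^ 3 * \<nu>) * (\<Delta>t - 1 / \<nu> * (1 - exp (- \<nu> * \<Delta>t))))"

definition coefD :: "real \<Rightarrow> real \<Rightarrow> real \<Rightarrow> real \<Rightarrow> real" where
  "coefD \<Delta>t \<epsilon> \<sigma> \<alpha> = (let \<nu> = nu \<epsilon> \<sigma> \<alpha> in
     - \<sigma> / (\<Delta>t * \<epsilon> ^ 4 * \<nu>\<^sup>2) *
       (\<Delta>t * (1 + exp (- \<nu> * \<Delta>t)) - 2 / \<nu> * (1 - exp (- \<nu> * \<Delta>t))))"

definition coefE :: "real \<Rightarrow> real \<Rightarrow> real \<Rightarrow> real \<Rightarrow> real" where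
  "coefE \<Delta>t \<epsilon> \<sigma> \<alpha> = (let \<nu> = nu \<epsilon> \<sigma> \<alpha> in
     1 / (\<Delta>t * \<epsilon> * \<nu>) * (\<Delta>t - 1 / \<nu> * (1 - exp (- \<nu> * \<Delta>t))))"

definition right_slope_half :: "real \<Rightarrow> real \<Rightarrow> real \<Rightarrow> real" where
  "right_slope_half \<Delta>x \<rho>1 \<rho>half = (\<rho>1 - \<rho>half) / (\<Delta>x / 2)"

definition interior_flux ::
  "real \<Rightarrow> real \<Rightarrow> real \<Rightarrow> real \<Rightarrow> real \<Rightarrow> (real \<Rightarrow> real) \<Rightarrow> (real \<Rightarrow> real) \<Rightarrow> real" where
  "interior_flux \<Delta>x \<Delta>t \<epsilon> \<sigma> \<alpha> f1 f2 =
     coefA \<Delta>t \<epsilon> \<sigma> \<alpha> * avg (\<lambda>v. v * f1 v * vpos v + v * f2 v * vneg v)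
     + coefD \<Delta>t \<epsilon> \<sigma> \<alpha> * (1 / 3) * ((avg f2 - avg f1) / \<Delta>x)"

definition micro_boundary_flux ::
  "real \<Rightarrow> real \<Rightarrow> real \<Rightarrow> real \<Rightarrow> real \<Rightarrow> real \<Rightarrow> (real \<Rightarrow> real) \<Rightarrow> real
     \<Rightarrow> (real \<Rightarrow> real) \<Rightarrow> real \<Rightarrow> real" where
  "micro_boundary_flux \<Delta>x \<Delta>t \<epsilon> \<sigma> \<alpha> G fL \<rho>half f1 v =
     v / \<epsilon> * fL v * vpos v
     + coefA \<Delta>t \<epsilon> \<sigma> \<alpha> * v * f1 v * vneg v
     + coefC \<Delta>t \<epsilon> \<sigma> \<alpha> * v * \<rho>half * vneg v
     + coefD \<Delta>t \<epsilon> \<sigma> \<alpha> * v\<^sup>2 * right_slope_half \<Delta>x (avg f1) \<rho>half * vneg v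
     + coefE \<Delta>t \<epsilon> \<sigma> \<alpha> * v * G * vneg v"

(* Not the velocity average of micro_boundary_flux: the incoming part <v f_L 1_{v>0}> / epsilon
   is replaced by the flux - 2 <v 1_{v<0}> <W f_L 1_{v>0}> / epsilon. *)
definition corrected_boundary_flux ::
  "real \<Rightarrow> real \<Rightarrow> real \<Rightarrow> real \<Rightarrow> real \<Rightarrow> real \<Rightarrow> (real \<Rightarrow> real) \<Rightarrow> (real \<Rightarrow> real)
     \<Rightarrow> real \<Rightarrow> (real \<Rightarrow> real) \<Rightarrow> real" where
  "corrected_boundary_flux \<Delta>x \<Delta>t \<epsilon> \<sigma> \<alpha> G W fL \<rho>half f1 =
     - (2 * avg (\<lambda>v. v * vneg v) / \<epsilon>) * avg (\<lambda>v. W v * fL v * vpos v)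
     + coefA \<Delta>t \<epsilon> \<sigma> \<alpha> * avg (\<lambda>v. v * f1 v * vneg v)
     + avg (\<lambda>v. v * vneg v) * coefC \<Delta>t \<epsilon> \<sigma> \<alpha> * \<rho>half
     + avg (\<lambda>v. v\<^sup>2 * vneg v) * coefD \<Delta>t \<epsilon> \<sigma> \<alpha> * right_slope_half \<Delta>x (avg f1) \<rho>half
     + avg (\<lambda>v. v * vneg v) * coefE \<Delta>t \<epsilon> \<sigma> \<alpha> * G"

end

theory Submission
  imports Defs "HOL-Real_Asymp.Real_Asymp"
begin

text \<open>
  The incoming flux of the corrected scheme is \<open>- 2 <v 1_{v<0}> <W f_L 1_{v>0}> / \<epsilon>\<close>, which, since
  \<open><v 1_{v<0}> = -1/4\<close>, equals \<open>\<rho> / (4 \<epsilon>)\<close> for the boundary value \<open>\<rho> = 2 <W f_L 1_{v>0}>\<close>.  The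
  outgoing flux contains \<open>- C \<rho> / 4\<close>, and \<open>C\<close> also blows up like \<open>1 / \<epsilon>\<close>.  The correction is chosen
  so that the two singular parts meet in the single term \<open>(1 / \<epsilon> - C) \<rho> / 4\<close>
  (\<open>corrected_boundary_flux_eq\<close>), and \<open>1 / \<epsilon> - C \<rightarrow> 0\<close> (\<open>inverse_minus_coefC_tendsto\<close>).  Every other
  term in either flux is a coefficient with a finite limit (\<open>A, E \<rightarrow> 0\<close> and \<open>D \<rightarrow> -1/\<sigma>\<close>) times the
  source \<open>G\<close>, a velocity moment or a slope, all bounded because \<open><|f_1|>\<close> and \<open><|f_2|>\<close> are.

  Boundedness on all of \<open>(0, \<epsilon>0]\<close> follows, as the coefficients are continuous there and have limits
  at \<open>0\<close>.  For the limit equation, the moments need not converge, so the discrete conservation law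
  is compared with the diffusion scheme at the same \<open>\<epsilon>\<close>: the residual is a sum of products of
  null coefficients and bounded moments.  The half cell in the slope turns \<open><v^2 1_{v<0}> = 1/6\<close> into
  the diffusion constant \<open>1/3\<close>.  When the densities \<open>\<rho>_1\<close> and \<open>\<rho>_2\<close> do converge, the scheme is linear
  in \<open>\<rho>_1^{n+1}\<close> with factor \<open>1 / \<Delta>t + \<alpha>_1\<close>, and solving for it gives its limit.
\<close>

section \<open>The flux coefficients for small \<open>\<epsilon>\<close>\<close>

lemma coefA_tendsto:
  assumes "\<sigma> > 0" "\<Delta>t > 0"
  shows "((\<lambda>\<epsilon>. coefA \<Delta>t \<epsilon> \<sigma> \<alpha>) \<longlongrightarrow> 0) (at_right 0)"
  unfolding coefA_def nu_def Let_def using assms by real_asymp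

text \<open>
  With \<open>k = \<sigma> + \<alpha> \<epsilon>^2\<close> one has \<open>\<nu> = k / \<epsilon>^2\<close>, and the leading term \<open>\<sigma> / (\<epsilon> k)\<close> of \<open>C\<close> cancels
  \<open>1 / \<epsilon>\<close> exactly up to \<open>\<alpha> \<epsilon> / k\<close>; the rest of \<open>C\<close> is already \<open>O(\<epsilon>)\<close>.
\<close>
lemma inverse_minus_coefC_tendsto:
  assumes "\<sigma> > 0" "\<Delta>t > 0"
  shows "((\<lambda>\<epsilon>. 1 / \<epsilon> - coefC \<Delta>t \<epsilon> \<sigma> \<alpha>) \<longlongrightarrow> 0) (at_right 0)"
proof -
  have "((\<lambda>\<epsilon>. \<alpha> * \<epsilon> / (\<sigma> + \<alpha> * \<epsilon>\<^sup>2) +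
    \<sigma> * \<epsilon> / (\<Delta>t * (\<sigma> + \<alpha> * \<epsilon>\<^sup>2)\<^sup>2) * (1 - exp (- (\<sigma> / \<epsilon>\<^sup>2 + \<alpha>) * \<Delta>t))) \<longlongrightarrow> 0) (at_right 0)"
    (is "(?g \<longlongrightarrow> _) _")
    using assms by real_asymp
  moreover have "\<forall>\<^sub>F \<epsilon> in at_right 0. \<sigma> + \<alpha> * \<epsilon>\<^sup>2 > 0"
    using assms by real_asymp
  moreover have "\<forall>\<^sub>F \<epsilon>::real in at_right 0. \<epsilon> > 0"
    by (rule eventually_at_right_less)
  ultimately show ?thesis
  proof (elim Lim_transform_eventually)
    show "\<forall>\<^sub>F \<epsilon> in at_right 0. ?g \<epsilon> = 1 / \<epsilon> - coefC \<Delta>t \<epsilon> \<sigma> \<alpha>"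
      if "\<forall>\<^sub>F \<epsilon> in at_right 0. \<sigma> + \<alpha> * \<epsilon>\<^sup>2 > 0" "\<forall>\<^sub>F \<epsilon>::real in at_right 0. \<epsilon> > 0"
      using that
    proof eventually_elim
      case (elim \<epsilon>)
      define e where "e = 1 - exp (- nu \<epsilon> \<sigma> \<alpha> * \<Delta>t)"
      have n: "nu \<epsilon> \<sigma> \<alpha> = (\<sigma> + \<alpha> * \<epsilon>\<^sup>2) / \<epsilon>\<^sup>2"
        using elim by (simp add: nu_def field_simps)
      define k where "k = \<sigma> + \<alpha> * \<epsilon>\<^sup>2"
      have k: "k > 0" using elim by (simp add: k_def)
      have "1 / \<epsilon> - coefC \<Delta>t \<epsilon> \<sigma> \<alpha> =
          1 / \<epsilon> - \<sigma> / (\<Delta>t * \<epsilon> ^ 3 * (k / \<epsilon>\<^sup>2)) * (\<Delta>t - 1 / (k / \<epsilon>\<^sup>2) * e)"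
        by (simp add: coefC_def Let_def e_def n k_def)
      also have "\<dots> = (k - \<sigma>) / (\<epsilon> * k) + \<sigma> * \<epsilon> / (\<Delta>t * k\<^sup>2) * e"
        using elim k assms by (simp add: field_simps power2_eq_square power3_eq_cube)
      also have "(k - \<sigma>) / (\<epsilon> * k) = \<alpha> * \<epsilon> / k"
      proof -
        have "k - \<sigma> = \<alpha> * \<epsilon>\<^sup>2" by (simp add: k_def)
        then show ?thesis using elim by (simp add: power2_eq_square)
      qed
      finally show ?case
        by (simp add: e_def k_def nu_def)
    qed
  qed
qed

lemma coefD_tendsto:
  assumes "\<sigma> > 0" "\<Delta>t > 0"
  shows "((\<lambda>\<epsilon>. coefD \<Delta>t \<epsilon> \<sigma> \<alpha>) \<longlongrightarrow> - 1 / \<sigma>) (at_right 0)"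
  unfolding coefD_def nu_def Let_def using assms by (real_asymp simp: field_simps power2_eq_square)

lemma coefE_tendsto:
  assumes "\<sigma> > 0" "\<Delta>t > 0"
  shows "((\<lambda>\<epsilon>. coefE \<Delta>t \<epsilon> \<sigma> \<alpha>) \<longlongrightarrow> 0) (at_right 0)"
  unfolding coefE_def nu_def Let_def using assms by real_asymp

lemma coef_continuous:
  assumes "\<And>\<epsilon>. \<epsilon> \<in> S \<Longrightarrow> nu \<epsilon> \<sigma> \<alpha> \<noteq> 0" "0 \<notin> S" "\<Delta>t > 0"
  shows "continuous_on S (\<lambda>\<epsilon>. coefA \<Delta>t \<epsilon> \<sigma> \<alpha>)"
    "continuous_on S (\<lambda>\<epsilon>. 1 / \<epsilon> - coefC \<Delta>t \<epsilon> \<sigma> \<alpha>)"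
    "continuous_on S (\<lambda>\<epsilon>. coefD \<Delta>t \<epsilon> \<sigma> \<alpha>)"
    "continuous_on S (\<lambda>\<epsilon>. coefE \<Delta>t \<epsilon> \<sigma> \<alpha>)"
proof -
  have nz: "\<epsilon> \<noteq> 0" if "\<epsilon> \<in> S" for \<epsilon> using assms(2) that by metis
  have c: "continuous_on S (\<lambda>\<epsilon>. nu \<epsilon> \<sigma> \<alpha>)"
    unfolding nu_def by (intro continuous_intros) (use nz in auto)
  show "continuous_on S (\<lambda>\<epsilon>. coefA \<Delta>t \<epsilon> \<sigma> \<alpha>)"
    "continuous_on S (\<lambda>\<epsilon>. 1 / \<epsilon> - coefC \<Delta>t \<epsilon> \<sigma> \<alpha>)"
    "continuous_on S (\<lambda>\<epsilon>. coefD \<Delta>t \<epsilon> \<sigma> \<alpha>)"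
    "continuous_on S (\<lambda>\<epsilon>. coefE \<Delta>t \<epsilon> \<sigma> \<alpha>)"
    unfolding coefA_def coefC_def coefD_def coefE_def Let_def
    by (intro continuous_intros c; use nz assms in auto)+
qed

text \<open>
  The limit controls the function near \<open>0\<close>, compactness on the rest of the interval.
\<close>
lemma bounded_of_tendsto_at_right:
  fixes g :: "real \<Rightarrow> real"
  assumes "continuous_on {0<..a} g" "(g \<longlongrightarrow> L) (at_right 0)"
  obtains M where "\<And>x. x \<in> {0<..a} \<Longrightarrow> \<bar>g x\<bar> \<le> M" "0 \<le> M"
proof -
  have "\<forall>\<^sub>F x in at_right 0. \<bar>g x - L\<bar> < 1"
    using tendstoD[OF assms(2), of 1] by (simp add: dist_real_def)
  then obtain b where b: "b > 0" "\<And>x. 0 < x \<Longrightarrow> x < b \<Longrightarrow> \<bar>g x - L\<bar> < 1"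
    unfolding eventually_at_right_field by blast
  have "compact (g ` {b..a})"
    using b by (intro compact_continuous_image continuous_on_subset[OF assms(1)]) auto
  then obtain K where K: "\<And>x. x \<in> {b..a} \<Longrightarrow> \<bar>g x\<bar> \<le> K"
    by (metis compact_imp_bounded bounded_iff imageI real_norm_def)
  show ?thesis
  proof (rule that[of "max (\<bar>L\<bar> + 1) K"])
    fix x assume "x \<in> {0<..a}"
    then show "\<bar>g x\<bar> \<le> max (\<bar>L\<bar> + 1) K"
      using b(2)[of x] K[of x] by (cases "x < b") auto
  qed auto
qed

section \<open>Velocity averages\<close>

lemma avg_vneg:
  "avg (\<lambda>v. v * vneg v) = - (1 / 4)" "avg (\<lambda>v. v\<^sup>2 * vneg v) = 1 / 6"
proof -
  have *: "avg (\<lambda>v. v ^ k * vneg v) = - ((-1) ^ Suc k) / (2 * Suc k)" if "k > 0" for k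
  proof -
    have "(LBINT v:{-1..1}. v ^ k * vneg v) = (\<integral>v. v ^ k * indicator {-1..0} v \<partial>lborel)"
      unfolding set_lebesgue_integral_def using that
      by (intro Bochner_Integration.integral_cong) (auto simp: indicator_def)
    then show ?thesis
      by (simp add: avg_def integral_power)
  qed
  show "avg (\<lambda>v. v * vneg v) = - (1 / 4)" "avg (\<lambda>v. v\<^sup>2 * vneg v) = 1 / 6"
    using *[of 1] *[of 2] by simp_all
qed

lemma abs_avg_le:
  assumes "set_integrable lborel {-1..1} f" "set_integrable lborel {-1..1} g"
    and "\<And>v. v \<in> {-1..1} \<Longrightarrow> \<bar>g v\<bar> \<le> \<bar>f v\<bar>"
  shows "\<bar>avg g\<bar> \<le> avg (\<lambda>v. \<bar>f v\<bar>)"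
proof -
  have "\<bar>LBINT v:{-1..1}. g v\<bar> \<le> (LBINT v:{-1..1}. \<bar>g v\<bar>)"
    using set_integral_norm_bound[OF assms(2)] by simp
  also have "\<dots> \<le> (LBINT v:{-1..1}. \<bar>f v\<bar>)"
    using assms by (intro set_integral_mono set_integrable_abs) auto
  finally show ?thesis
    by (simp add: avg_def)
qed

lemma set_integrable_mult_bounded:
  fixes f w :: "real \<Rightarrow> real"
  assumes f: "set_integrable lborel A f" and w: "w \<in> borel_measurable lborel"
    and A: "\<And>x. x \<in> A \<Longrightarrow> \<bar>w x\<bar> \<le> 1"
  shows "set_integrable lborel A (\<lambda>x. w x * f x)"
proof (rule set_integrable_bound[OF f])
  have "(\<lambda>x. indicator A x * f x) \<in> borel_measurable lborel"
    using f by (auto simp: set_integrable_def)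
  with w have "(\<lambda>x. w x * (indicator A x * f x)) \<in> borel_measurable lborel"
    by (rule borel_measurable_times)
  then show "set_borel_measurable lborel A (\<lambda>x. w x * f x)"
    by (simp add: set_borel_measurable_def mult.left_commute)
qed (use A mult_right_mono in \<open>fastforce simp: abs_mult\<close>)

text \<open>
  The indicator of \<open>v > 0\<close> and that of \<open>[0,1]\<close> differ only at \<open>v = 0\<close>, a null set.
\<close>
lemma avg_vpos:
  assumes "set_integrable lborel {0..1} g"
  shows "2 * avg (\<lambda>v. g v * vpos v) = (LBINT v:{0..1}. g v)"
proof -
  have m: "(\<lambda>v. indicator {0..1} v * g v) \<in> borel_measurable lborel"
    using assms by (auto simp: set_integrable_def)
  have eq: "(\<lambda>v. indicator {-1..1} v * (g v * vpos v)) = (\<lambda>v. (indicator {0..1} v * g v) * vpos v)"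
    by (auto simp: indicator_def)
  have "AE v in lborel. (indicator {0..1} v * g v) * vpos v = indicator {0..1} v * g v"
    using AE_lborel_singleton[of "0::real"] by eventually_elim (auto simp: indicator_def)
  moreover have "(\<lambda>v. (indicator {0..1} v * g v) * vpos v) \<in> borel_measurable lborel"
    by (intro borel_measurable_times m) auto
  ultimately show ?thesis
    using m by (auto simp: avg_def set_lebesgue_integral_def eq intro!: integral_cong_AE)
qed

section \<open>Boundary and interior fluxes\<close>

text \<open>
  The regrouping in which the singular terms of the boundary flux become visible as the one
  factor \<open>1 / \<epsilon> - C\<close>; the remaining terms have the shape of the interior flux.
\<close>
lemma corrected_boundary_flux_eq:
  assumes "\<rho> = 2 * avg (\<lambda>v. W v * fL v * vpos v)" "\<Delta>x > 0"
  shows "corrected_boundary_flux \<Delta>x \<Delta>t \<epsilon> \<sigma> \<alpha> G W fL \<rho> f =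
    (1 / \<epsilon> - coefC \<Delta>t \<epsilon> \<sigma> \<alpha>) * (\<rho> / 4)
    + coefA \<Delta>t \<epsilon> \<sigma> \<alpha> * avg (\<lambda>v. v * f v * vneg v)
    + coefD \<Delta>t \<epsilon> \<sigma> \<alpha> * ((avg f - \<rho>) / (3 * \<Delta>x))
    - coefE \<Delta>t \<epsilon> \<sigma> \<alpha> * (G / 4)"
  using assms(2)
  unfolding corrected_boundary_flux_def right_slope_half_def avg_vneg assms(1)
  by (simp add: field_simps)

text \<open>
  On \<open>[-1,1]\<close> the weights \<open>v 1_{v>0}\<close> and \<open>v 1_{v<0}\<close> are bounded by \<open>1\<close>; taking \<open>f = 0\<close> gives the
  outgoing moment in the boundary flux.
\<close>
lemma avg_upwind_le:
  assumes f: "set_integrable lborel {-1..1} f" and g: "set_integrable lborel {-1..1} g"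
  shows "\<bar>avg (\<lambda>v. v * f v * vpos v + v * g v * vneg v)\<bar>
    \<le> avg (\<lambda>v. \<bar>f v\<bar>) + avg (\<lambda>v. \<bar>g v\<bar>)"
proof -
  have *: "set_integrable lborel {-1..1} (\<lambda>v. v * h v * indicator X v)"
    "\<bar>avg (\<lambda>v. v * h v * indicator X v)\<bar> \<le> avg (\<lambda>v. \<bar>h v\<bar>)"
    if h: "set_integrable lborel {-1..1} h" and X: "X \<in> sets borel" for h and X :: "real set"
  proof -
    have "set_integrable lborel {-1..1} (\<lambda>v. (v * indicator X v) * h v)"
      using X by (intro set_integrable_mult_bounded h) (auto simp: indicator_def)
    then show i: "set_integrable lborel {-1..1} (\<lambda>v. v * h v * indicator X v)"
      by (simp add: mult_ac)
    show "\<bar>avg (\<lambda>v. v * h v * indicator X v)\<bar> \<le> avg (\<lambda>v. \<bar>h v\<bar>)"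
      by (rule abs_avg_le[OF h i]) (auto simp: indicator_def abs_mult mult_left_le_one_le)
  qed
  have "avg (\<lambda>v. v * f v * vpos v + v * g v * vneg v) =
      avg (\<lambda>v. v * f v * vpos v) + avg (\<lambda>v. v * g v * vneg v)"
    unfolding avg_def by (subst set_integral_add(2)) (use *(1)[OF f] *(1)[OF g] in \<open>simp_all add: distrib_left\<close>)
  then show ?thesis
    using *(2)[OF f, of "{0<..}"] *(2)[OF g, of "{..<0}"] by auto
qed

section \<open>The diffusion limit with the corrected boundary value\<close>

theorem mainTheorem6:
  fixes \<Delta>x \<Delta>t \<sigma>half \<sigma>3half \<alpha>half \<alpha>3half \<alpha>1 G \<epsilon>0 \<rho>half :: real
    and W fL :: "real \<Rightarrow> real"
    and f1 f2 \<phi>half :: "real \<Rightarrow> real \<Rightarrow> real"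
    and \<rho>1next \<Phi>half \<Phi>3half :: "real \<Rightarrow> real"
  assumes dx: "\<Delta>x > 0" and dt: "\<Delta>t > 0" and eps0: "\<epsilon>0 > 0"
    and sigma: "\<sigma>half > 0" "\<sigma>3half > 0"
    and nu: "\<And>\<epsilon>. \<epsilon> \<in> {0<..\<epsilon>0} \<Longrightarrow> nu \<epsilon> \<sigma>half \<alpha>half \<noteq> 0 \<and> nu \<epsilon> \<sigma>3half \<alpha>3half \<noteq> 0"
    and alpha1: "1 + \<alpha>1 * \<Delta>t \<noteq> 0"
    and W: "boundary_layer_weight W"
    and fL: "set_integrable lborel {0..1} (\<lambda>v. W v * fL v)"
    and f_int: "\<And>\<epsilon>. \<epsilon> \<in> {0<..\<epsilon>0} \<Longrightarrow>
          set_integrable lborel {-1..1} (f1 \<epsilon>) \<and> set_integrable lborel {-1..1} (f2 \<epsilon>)"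
    and f_bound: "\<exists>B. \<forall>\<epsilon>\<in>{0<..\<epsilon>0}. avg (\<lambda>v. \<bar>f1 \<epsilon> v\<bar>) \<le> B \<and> avg (\<lambda>v. \<bar>f2 \<epsilon> v\<bar>) \<le> B"
    and rho_half: "\<rho>half = 2 * avg (\<lambda>v. W v * fL v * vpos v)"
    and phi_half: "\<And>\<epsilon> v. \<epsilon> \<in> {0<..\<epsilon>0} \<Longrightarrow> v \<in> {-1..1} \<Longrightarrow>
          \<phi>half \<epsilon> v = micro_boundary_flux \<Delta>x \<Delta>t \<epsilon> \<sigma>half \<alpha>half G fL \<rho>half (f1 \<epsilon>) v"
    and Phi_half: "\<And>\<epsilon>. \<epsilon> \<in> {0<..\<epsilon>0} \<Longrightarrow>
          \<Phi>half \<epsilon> = corrected_boundary_flux \<Delta>x \<Delta>t \<epsilon> \<sigma>half \<alpha>half G W fL \<rho>half (f1 \<epsilon>)"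
    and Phi_3half: "\<And>\<epsilon>. \<epsilon> \<in> {0<..\<epsilon>0} \<Longrightarrow>
          \<Phi>3half \<epsilon> = interior_flux \<Delta>x \<Delta>t \<epsilon> \<sigma>3half \<alpha>3half (f1 \<epsilon>) (f2 \<epsilon>)"
    and conservation: "\<And>\<epsilon>. \<epsilon> \<in> {0<..\<epsilon>0} \<Longrightarrow>
          (\<rho>1next \<epsilon> - avg (f1 \<epsilon>)) / \<Delta>t + 1 / \<Delta>x * (\<Phi>3half \<epsilon> - \<Phi>half \<epsilon>)
            = - \<alpha>1 * \<rho>1next \<epsilon> + G"
  shows "(\<exists>M. \<forall>\<epsilon>\<in>{0<..\<epsilon>0}. \<bar>\<Phi>half \<epsilon>\<bar> \<le> M)
    \<and> ((\<lambda>\<epsilon>. ((\<rho>1next \<epsilon> - avg (f1 \<epsilon>)) / \<Delta>t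
            - 1 / \<Delta>x * (1 / (3 * \<sigma>3half) * ((avg (f2 \<epsilon>) - avg (f1 \<epsilon>)) / \<Delta>x)
                       - 1 / (3 * \<sigma>half) * ((avg (f1 \<epsilon>) - \<rho>half) / \<Delta>x)))
            - (- \<alpha>1 * \<rho>1next \<epsilon> + G)) \<longlongrightarrow> 0) (at_right 0)
    \<and> (\<forall>\<rho>1 \<rho>2. ((\<lambda>\<epsilon>. avg (f1 \<epsilon>)) \<longlongrightarrow> \<rho>1) (at_right 0) \<longrightarrow>
               ((\<lambda>\<epsilon>. avg (f2 \<epsilon>)) \<longlongrightarrow> \<rho>2) (at_right 0) \<longrightarrow>
          (\<exists>\<rho>1'. (\<rho>1next \<longlongrightarrow> \<rho>1') (at_right 0) \<and>
             (\<rho>1' - \<rho>1) / \<Delta>t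
               - 1 / \<Delta>x * (1 / (3 * \<sigma>3half) * ((\<rho>2 - \<rho>1) / \<Delta>x)
                          - 1 / (3 * \<sigma>half) * ((\<rho>1 - \<rho>half) / \<Delta>x))
             = - \<alpha>1 * \<rho>1' + G))
    \<and> \<rho>half = (LBINT v:{0..1}. W v * fL v)"
proof -
  define S where "S = {0<..\<epsilon>0}"
  \<comment> \<open>\<open>R\<close> is what remains of the coefficient \<open>C\<close> once its singularity has cancelled.\<close>
  define A R D E where "A = (\<lambda>\<epsilon>. coefA \<Delta>t \<epsilon> \<sigma>half \<alpha>half)"
    and "R = (\<lambda>\<epsilon>. 1 / \<epsilon> - coefC \<Delta>t \<epsilon> \<sigma>half \<alpha>half)"
    and "D = (\<lambda>\<epsilon>. coefD \<Delta>t \<epsilon> \<sigma>half \<alpha>half)"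
    and "E = (\<lambda>\<epsilon>. coefE \<Delta>t \<epsilon> \<sigma>half \<alpha>half)"
  define A3 D3 where "A3 = (\<lambda>\<epsilon>. coefA \<Delta>t \<epsilon> \<sigma>3half \<alpha>3half)"
    and "D3 = (\<lambda>\<epsilon>. coefD \<Delta>t \<epsilon> \<sigma>3half \<alpha>3half)"
  \<comment> \<open>The slopes carry the factor \<open>1/3\<close>, so that \<open>D * s\<close> and \<open>D3 * s3\<close> are the diffusive parts of the fluxes.\<close>
  define m m3 s s3 where "m = (\<lambda>\<epsilon>. avg (\<lambda>v. v * f1 \<epsilon> v * vneg v))"
    and "m3 = (\<lambda>\<epsilon>. avg (\<lambda>v. v * f1 \<epsilon> v * vpos v + v * f2 \<epsilon> v * vneg v))"
    and "s = (\<lambda>\<epsilon>. (avg (f1 \<epsilon>) - \<rho>half) / (3 * \<Delta>x))"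
    and "s3 = (\<lambda>\<epsilon>. (avg (f2 \<epsilon>) - avg (f1 \<epsilon>)) / (3 * \<Delta>x))"
  have flux: "\<Phi>half \<epsilon> = R \<epsilon> * (\<rho>half / 4) + A \<epsilon> * m \<epsilon> + D \<epsilon> * s \<epsilon> - E \<epsilon> * (G / 4)"
    if "\<epsilon> \<in> S" for \<epsilon>
    using that Phi_half[of \<epsilon>] corrected_boundary_flux_eq[OF rho_half dx]
    by (simp add: A_def R_def D_def E_def m_def s_def S_def)
  have flux3: "\<Phi>3half \<epsilon> = A3 \<epsilon> * m3 \<epsilon> + D3 \<epsilon> * s3 \<epsilon>" if "\<epsilon> \<in> S" for \<epsilon>
    using that Phi_3half[of \<epsilon>] dx
    by (simp add: interior_flux_def A3_def D3_def m3_def s3_def S_def)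

  obtain B where B: "avg (\<lambda>v. \<bar>f1 \<epsilon> v\<bar>) \<le> B" "avg (\<lambda>v. \<bar>f2 \<epsilon> v\<bar>) \<le> B" if "\<epsilon> \<in> S" for \<epsilon>
    using f_bound unfolding S_def by metis
  have avg_bound: "\<bar>avg (f1 \<epsilon>)\<bar> \<le> B" "\<bar>avg (f2 \<epsilon>)\<bar> \<le> B" if "\<epsilon> \<in> S" for \<epsilon>
    using that B[of \<epsilon>] f_int[of \<epsilon>] abs_avg_le[of "f1 \<epsilon>" "f1 \<epsilon>"] abs_avg_le[of "f2 \<epsilon>" "f2 \<epsilon>"]
    by (auto simp: S_def)
  have m: "\<bar>m \<epsilon>\<bar> \<le> B" if "\<epsilon> \<in> S" for \<epsilon>
    using that B[of \<epsilon>] f_int[of \<epsilon>] avg_upwind_le[of "\<lambda>_. 0" "f1 \<epsilon>"]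
    by (auto simp: S_def m_def avg_def set_integrable_def)
  have m3: "\<bar>m3 \<epsilon>\<bar> \<le> 2 * B" if "\<epsilon> \<in> S" for \<epsilon>
    using that B[of \<epsilon>] f_int[of \<epsilon>] avg_upwind_le[of "f1 \<epsilon>" "f2 \<epsilon>"]
    by (auto simp: S_def m3_def)
  have s: "\<bar>s \<epsilon>\<bar> \<le> (B + \<bar>\<rho>half\<bar>) / (3 * \<Delta>x)" if "\<epsilon> \<in> S" for \<epsilon>
    using that avg_bound[of \<epsilon>] dx by (auto simp: s_def abs_divide intro!: divide_right_mono)
  have s3: "\<bar>s3 \<epsilon>\<bar> \<le> 2 * B / (3 * \<Delta>x)" if "\<epsilon> \<in> S" for \<epsilon>
    using that avg_bound[of \<epsilon>] dx by (auto simp: s3_def abs_divide intro!: divide_right_mono)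

  note lim = coefA_tendsto[OF sigma(1) dt, of \<alpha>half, folded A_def]
    inverse_minus_coefC_tendsto[OF sigma(1) dt, of \<alpha>half, folded R_def]
    coefD_tendsto[OF sigma(1) dt, of \<alpha>half, folded D_def]
    coefE_tendsto[OF sigma(1) dt, of \<alpha>half, folded E_def]
    coefA_tendsto[OF sigma(2) dt, of \<alpha>3half, folded A3_def]
    coefD_tendsto[OF sigma(2) dt, of \<alpha>3half, folded D3_def]
  have nu': "nu \<epsilon> \<sigma>half \<alpha>half \<noteq> 0" if "\<epsilon> \<in> S" for \<epsilon>
    using nu that by (auto simp: S_def)
  have "0 \<notin> S" by (simp add: S_def)
  note cont = coef_continuous[OF nu' this dt, folded A_def R_def D_def E_def, unfolded S_def]
  obtain MA where MA: "\<And>\<epsilon>. \<epsilon> \<in> S \<Longrightarrow> \<bar>A \<epsilon>\<bar> \<le> MA" "0 \<le> MA"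
    using bounded_of_tendsto_at_right[OF cont(1) lim(1)] unfolding S_def by blast
  obtain MR where MR: "\<And>\<epsilon>. \<epsilon> \<in> S \<Longrightarrow> \<bar>R \<epsilon>\<bar> \<le> MR" "0 \<le> MR"
    using bounded_of_tendsto_at_right[OF cont(2) lim(2)] unfolding S_def by blast
  obtain MD where MD: "\<And>\<epsilon>. \<epsilon> \<in> S \<Longrightarrow> \<bar>D \<epsilon>\<bar> \<le> MD" "0 \<le> MD"
    using bounded_of_tendsto_at_right[OF cont(3) lim(3)] unfolding S_def by blast
  obtain ME where ME: "\<And>\<epsilon>. \<epsilon> \<in> S \<Longrightarrow> \<bar>E \<epsilon>\<bar> \<le> ME" "0 \<le> ME"
    using bounded_of_tendsto_at_right[OF cont(4) lim(4)] unfolding S_def by blast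
  have bounded: "\<exists>M. \<forall>\<epsilon>\<in>{0<..\<epsilon>0}. \<bar>\<Phi>half \<epsilon>\<bar> \<le> M"
  proof (intro exI ballI)
    fix \<epsilon> assume "\<epsilon> \<in> {0<..\<epsilon>0}"
    then have \<epsilon>: "\<epsilon> \<in> S" by (simp add: S_def)
    have "\<bar>R \<epsilon> * (\<rho>half / 4)\<bar> \<le> MR * \<bar>\<rho>half / 4\<bar>" "\<bar>A \<epsilon> * m \<epsilon>\<bar> \<le> MA * B"
      "\<bar>D \<epsilon> * s \<epsilon>\<bar> \<le> MD * ((B + \<bar>\<rho>half\<bar>) / (3 * \<Delta>x))" "\<bar>E \<epsilon> * (G / 4)\<bar> \<le> ME * \<bar>G / 4\<bar>"
      unfolding abs_mult using MA MR MD ME m s \<epsilon> by (intro mult_mono; simp)+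
    then show "\<bar>\<Phi>half \<epsilon>\<bar> \<le> MR * \<bar>\<rho>half / 4\<bar> + MA * B
        + MD * ((B + \<bar>\<rho>half\<bar>) / (3 * \<Delta>x)) + ME * \<bar>G / 4\<bar>"
      unfolding flux[OF \<epsilon>] by linarith
  qed

  define K where "K \<rho>1 \<rho>2 = 1 / \<Delta>x * (1 / (3 * \<sigma>3half) * ((\<rho>2 - \<rho>1) / \<Delta>x)
      - 1 / (3 * \<sigma>half) * ((\<rho>1 - \<rho>half) / \<Delta>x))" for \<rho>1 \<rho>2
  \<comment> \<open>The residual of the limit scheme, evaluated at positive \<open>\<epsilon>\<close>.\<close>
  define r where "r \<epsilon> = (\<rho>1next \<epsilon> - avg (f1 \<epsilon>)) / \<Delta>t - K (avg (f1 \<epsilon>)) (avg (f2 \<epsilon>))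
      - (- \<alpha>1 * \<rho>1next \<epsilon> + G)" for \<epsilon>
  have S: "\<forall>\<^sub>F \<epsilon> in at_right 0. \<epsilon> \<in> S"
    using eps0 unfolding S_def eventually_at_right_field by auto
  have null: "((\<lambda>\<epsilon>. c \<epsilon> * b \<epsilon>) \<longlongrightarrow> 0) (at_right 0)"
    if "(c \<longlongrightarrow> 0) (at_right 0)" "\<And>\<epsilon>. \<epsilon> \<in> S \<Longrightarrow> \<bar>b \<epsilon>\<bar> \<le> M" for c b :: "real \<Rightarrow> real" and M
    by (rule lim_null_mult_right_bounded[OF that(1), of _ M])
       (use that(2) in \<open>auto intro: eventually_mono[OF S]\<close>)
  have D_null: "((\<lambda>\<epsilon>. D \<epsilon> + 1 / \<sigma>half) \<longlongrightarrow> 0) (at_right 0)"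
    "((\<lambda>\<epsilon>. D3 \<epsilon> + 1 / \<sigma>3half) \<longlongrightarrow> 0) (at_right 0)"
    using tendsto_add[OF lim(3) tendsto_const[of "1 / \<sigma>half"]]
      tendsto_add[OF lim(6) tendsto_const[of "1 / \<sigma>3half"]] by simp_all
  have "((\<lambda>\<epsilon>. - (1 / \<Delta>x) * ((A3 \<epsilon> * m3 \<epsilon> + (D3 \<epsilon> + 1 / \<sigma>3half) * s3 \<epsilon>)
      - (R \<epsilon> * (\<rho>half / 4) + A \<epsilon> * m \<epsilon> + (D \<epsilon> + 1 / \<sigma>half) * s \<epsilon> - E \<epsilon> * (G / 4)))) \<longlongrightarrow>
      - (1 / \<Delta>x) * ((0 + 0) - (0 + 0 + 0 - 0))) (at_right 0)"
    (is "(?r \<longlongrightarrow> _) _")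
    by (intro tendsto_intros null[OF lim(5) m3] null[OF D_null(2) s3] null[OF lim(1) m] null[OF D_null(1) s]
        tendsto_mult_left_zero lim(2,4))
  then have "(?r \<longlongrightarrow> 0) (at_right 0)" by simp
  moreover have "\<forall>\<^sub>F \<epsilon> in at_right 0. ?r \<epsilon> = r \<epsilon>"
    using S
  proof eventually_elim
    case (elim \<epsilon>)
    have K_eq: "K (avg (f1 \<epsilon>)) (avg (f2 \<epsilon>)) = 1 / \<Delta>x * (s3 \<epsilon> / \<sigma>3half - s \<epsilon> / \<sigma>half)"
      by (simp add: K_def s_def s3_def mult_ac)
    have "r \<epsilon> = - (1 / \<Delta>x) * (\<Phi>3half \<epsilon> - \<Phi>half \<epsilon>) - K (avg (f1 \<epsilon>)) (avg (f2 \<epsilon>))"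
      using conservation[of \<epsilon>] elim unfolding r_def S_def by simp
    then show ?case
      unfolding K_eq flux[OF elim] flux3[OF elim] by (simp add: algebra_simps)
  qed
  ultimately have r_null: "(r \<longlongrightarrow> 0) (at_right 0)"
    by (rule Lim_transform_eventually)

  have solve: "\<rho>1next = (\<lambda>\<epsilon>. (r \<epsilon> + avg (f1 \<epsilon>) / \<Delta>t + K (avg (f1 \<epsilon>)) (avg (f2 \<epsilon>)) + G) / (1 / \<Delta>t + \<alpha>1))"
    and solve': "1 / \<Delta>t + \<alpha>1 \<noteq> 0"
  proof -
    show nz: "1 / \<Delta>t + \<alpha>1 \<noteq> 0"
      using alpha1 dt by (simp add: field_simps)
    have "\<rho>1next \<epsilon> * (1 / \<Delta>t + \<alpha>1) = r \<epsilon> + avg (f1 \<epsilon>) / \<Delta>t + K (avg (f1 \<epsilon>)) (avg (f2 \<epsilon>)) + G" for \<epsilon>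
      by (simp add: r_def algebra_simps diff_divide_distrib)
    then show "\<rho>1next = (\<lambda>\<epsilon>. (r \<epsilon> + avg (f1 \<epsilon>) / \<Delta>t + K (avg (f1 \<epsilon>)) (avg (f2 \<epsilon>)) + G) / (1 / \<Delta>t + \<alpha>1))"
      using nz by (intro ext) (simp add: eq_divide_eq)
  qed
  have limit: "\<exists>\<rho>1'. (\<rho>1next \<longlongrightarrow> \<rho>1') (at_right 0) \<and>
      (\<rho>1' - \<rho>1) / \<Delta>t - K \<rho>1 \<rho>2 = - \<alpha>1 * \<rho>1' + G"
    if "((\<lambda>\<epsilon>. avg (f1 \<epsilon>)) \<longlongrightarrow> \<rho>1) (at_right 0)" "((\<lambda>\<epsilon>. avg (f2 \<epsilon>)) \<longlongrightarrow> \<rho>2) (at_right 0)" for \<rho>1 \<rho>2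
  proof (intro exI conjI)
    define l where "l = (0 + \<rho>1 / \<Delta>t + K \<rho>1 \<rho>2 + G) / (1 / \<Delta>t + \<alpha>1)"
    show "(\<rho>1next \<longlongrightarrow> l) (at_right 0)"
      unfolding l_def K_def
      by (subst solve, unfold K_def) (use dt dx sigma solve' in \<open>intro tendsto_intros r_null that; simp\<close>)
    have "l * (1 / \<Delta>t + \<alpha>1) = \<rho>1 / \<Delta>t + K \<rho>1 \<rho>2 + G"
      using solve' by (simp add: l_def)
    then show "(l - \<rho>1) / \<Delta>t - K \<rho>1 \<rho>2 = - \<alpha>1 * l + G"
      by (simp add: distrib_left diff_divide_distrib mult.commute)
  qed
  show ?thesis
    using bounded r_null limit avg_vpos[OF fL] rho_half
    unfolding r_def K_def by blast
qed

end
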